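(* For a nonnegative integer $n$, let $s_2(n)$ be the sum of the binary digits of $n$. Then for each integer $b\geq 2$ we have $$\mu\left(\sum_{n\geqslant 0}\frac{s_2(n)}{b^n}\right)=2,$$ where $\mu(\alpha)$ denotes the irrationality exponent of the real number $\alpha$.
   Context: For a real number $\alpha$, the irrationality exponent $\mu(\alpha)$ is defined as the supremum of the set of real numbers $\mu$ such that the inequality $$\left|\alpha-\frac{p}{q}\right|<\frac{1}{q^\mu}$$ has infinitely many solutions $(p,q)\in\mathbb{Z}\times\mathbb{N}$, where $\mathbb{N}$ is the set of positive integers. *)

theory Defs
  imports "HOL-Analysis.Analysis"
begin

fun s2 :: "nat \<Rightarrow> nat" where
  "s2 n = (if n = 0 then 0 else n mod 2 + s2 (n div 2))"

declare s2.simps [simp del]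

(* The supremum is taken in the extended reals because the set of exponents can be
   unbounded. Solutions are pairs (p, q), not fractions in lowest terms, so a rational
   number has exponent infinity. *)
definition irrationality_exponent :: "real \<Rightarrow> ereal" where
  "irrationality_exponent \<alpha> =
     Sup (ereal ` {\<mu> :: real. infinite {(p :: int, q :: nat). q > 0 \<and>
        \<bar>\<alpha> - real_of_int p / real q\<bar> < 1 / real q powr \<mu>}})"

lemma s2_le: "s2 n \<le> n"
proof (induction n rule: less_induct)
  case (less n)
  show ?case
  proof (cases "n = 0")
    case True
    then show ?thesis by (simp add: s2.simps)
  next
    case False
    then have "s2 (n div 2) \<le> n div 2" using less by simp
    moreover have "s2 n = n mod 2 + s2 (n div 2)" using False by (simp add: s2.simps[of n])
    ultimately show ?thesis by linarith
  qed
qed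

(* The series in the theorem converges, so suminf denotes its actual sum. *)
lemma summable_s2:
  fixes b :: int
  assumes "b \<ge> 2"
  shows "summable (\<lambda>n. real (s2 n) / real_of_int b ^ n)"
proof (rule summable_comparison_test')
  have "norm (1 / real_of_int b) < 1" using assms by simp
  then have "summable (\<lambda>n. diffs (\<lambda>_. 1) n * (1 / real_of_int b) ^ n)"
    by (intro termdiff_converges[where K = 1]) (auto intro: summable_geometric)
  then show "summable (\<lambda>n. real (Suc n) * (1 / real_of_int b) ^ n)"
    by (simp add: diffs_def)
next
  fix n :: nat
  have "real (s2 n) \<le> real (Suc n)" using s2_le[of n] by linarith
  then show "norm (real (s2 n) / real_of_int b ^ n) \<le> real (Suc n) * (1 / real_of_int b) ^ n"
    using assms by (simp add: power_one_over divide_simps)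
qed

end

theory Submission
  imports Defs "HOL-Analysis.Kronecker_Approximation_Theorem" "HOL-Library.Z2"
begin

text \<open>
  Let \<open>a n = s2 n - s2 (n - 1)\<close> (\<open>digit_sum_diff\<close> below) and \<open>g x = (\<Sum>n. a n * x ^ n)\<close>
  (\<open>diff_series\<close>). Telescoping gives
  \<open>g x = (1 - x) * (\<Sum>n. s2 n * x ^ n)\<close>, so the number \<open>\<alpha>\<close> of the theorem is a rational multiple of
  \<open>g (1 / b)\<close>. The series satisfies Mahler's equation \<open>g x = g (x\<^sup>2) + x / (1 + x)\<close>. Iterating it
  shows that \<open>g (1 / b)\<close> and \<open>g (1 / y)\<close> with \<open>y = b ^ 2 ^ m\<close> differ by a rational number whose
  denominator divides \<open>y - 1\<close>. Hence one Pade approximant of \<open>g\<close>, that is, one pair of integer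
  polynomials \<open>Q\<close>, \<open>P\<close> of degree at most \<open>k\<close> such that \<open>Q y * g (1 / y) - P y\<close> is of order
  \<open>y ^ -(k + 1)\<close>, yields rational approximations of \<open>\<alpha>\<close> for all large \<open>m\<close>: with denominators
  \<open>q\<close> of size at most \<open>y ^ (k + 1)\<close> up to a constant, and \<open>q * \<alpha> - p\<close> of size exactly
  \<open>y ^ -k\<close> up to constants. Letting \<open>k\<close> run through \<open>K < k \<le> 2 * K\<close> makes these approximations
  so dense that every other fraction can be compared with one of them
  (\<open>finite_solutions_of_good_approximations\<close>); the comparison bounds the exponent by
  \<open>2 + 3 / K\<close>, with \<open>K\<close> arbitrary.

  What has to be excluded is that \<open>Q y * g (1 / y) - P y\<close> is smaller than expected, that is, that
  a Hankel determinant of the sequence \<open>a\<close> vanishes. It is in fact odd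
  (\<open>hankel_nonsingular_mod2\<close>). Over the field with two elements \<open>g (x\<^sup>2) = (g x)\<^sup>2\<close>, so there
  the reduction \<open>h\<close> of \<open>g\<close> (\<open>series_mod2\<close>) is a root of the quadratic equation \<open>h\<^sup>2 + h = x / (1 + x)\<close>, whose
  other root is \<open>h + 1\<close>. A relation \<open>Q * h - P = O(x ^ (2 * k + 2))\<close> makes the norm form
  \<open>(Q * h - P) * (Q * (h + 1) - P)\<close>, multiplied by \<open>1 + x\<close>, a polynomial of degree at most
  \<open>2 * k + 1\<close> that is divisible by \<open>x ^ (2 * k + 2)\<close>. So it vanishes, and a comparison of degrees
  shows that the norm form vanishes only for \<open>Q = 0\<close>.

  The lower bound for the exponent is Dirichlet's approximation theorem.
\<close>

section \<open>Integer solutions of underdetermined linear systems\<close>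

text \<open>Gaussian elimination without division. Cross-multiplying with a pivot \<open>A k p\<close> removes the unknown
  \<open>p\<close> from the other equations. A solution of the smaller system, scaled by the pivot, extends to \<open>p\<close>
  by means of equation \<open>k\<close>.\<close>

lemma underdetermined_system_solution:
  fixes A :: "nat \<Rightarrow> 'b \<Rightarrow> 'a :: idom"
  assumes "finite J" "card J > k"
  shows "\<exists>v. (\<exists>j\<in>J. v j \<noteq> 0) \<and> (\<forall>i<k. (\<Sum>j\<in>J. A i j * v j) = 0)"
  using assms
proof (induction k arbitrary: J A)
  case 0
  then have "J \<noteq> {}" by auto
  then show ?case by (intro exI[of _ "\<lambda>_. 1"]) auto
next
  case (Suc k)
  show ?case
  proof (cases "\<forall>j\<in>J. A k j = 0")
    case True
    have "card J > k" using Suc.prems(2) by simp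
    from Suc.IH[OF Suc.prems(1) this, of A] show ?thesis
      using True by (auto simp: less_Suc_eq)
  next
    case False
    then obtain p where p: "p \<in> J" "A k p \<noteq> 0" by blast
    let ?B = "\<lambda>i j. A k p * A i j - A i p * A k j"
    have "finite (J - {p})" "card (J - {p}) > k" using Suc.prems p(1) by auto
    from Suc.IH[OF this, of ?B] obtain w j0 where w: "j0 \<in> J - {p}" "w j0 \<noteq> 0"
      "\<And>i. i < k \<Longrightarrow> (\<Sum>j\<in>J - {p}. ?B i j * w j) = 0" by blast
    define v where "v = (\<lambda>j. if j = p then - (\<Sum>j\<in>J - {p}. A k j * w j) else A k p * w j)"
    have "(\<Sum>j\<in>J. A i j * v j) = (\<Sum>j\<in>J - {p}. ?B i j * w j)" for i
    proof -
      have "(\<Sum>j\<in>J. A i j * v j) = A i p * v p + (\<Sum>j\<in>J - {p}. A i j * v j)"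
        using Suc.prems(1) p(1) by (rule sum.remove)
      also have "(\<Sum>j\<in>J - {p}. A i j * v j) = (\<Sum>j\<in>J - {p}. A k p * A i j * w j)"
        by (intro sum.cong) (auto simp: v_def)
      finally show ?thesis
        by (simp add: v_def left_diff_distrib sum_subtractf sum_distrib_left mult.assoc)
    qed
    moreover have "(\<Sum>j\<in>J - {p}. ?B i j * w j) = 0" if "i < Suc k" for i
      using that w(3)[of i] by (cases "i = k") (auto simp: less_Suc_eq)
    moreover have "\<exists>j\<in>J. v j \<noteq> 0" using w(1,2) p(2) by (intro bexI[of _ j0]) (auto simp: v_def)
    ultimately show ?thesis by auto
  qed
qed

text \<open>An integer solution can be divided by the greatest common divisor of its entries, after which it
  stays nonzero when it is reduced modulo 2.\<close>

lemma exists_kernel_vector_with_odd_entry: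
  fixes A :: "nat \<Rightarrow> nat \<Rightarrow> int"
  shows "\<exists>v. (\<exists>j\<le>k. odd (v j)) \<and> (\<forall>i<k. (\<Sum>j\<le>k. A i j * v j) = 0)"
proof -
  obtain u where "\<exists>j\<in>{..k}. u j \<noteq> 0" and sys: "\<And>i. i < k \<Longrightarrow> (\<Sum>j\<le>k. A i j * u j) = 0"
    using underdetermined_system_solution[of "{..k}" k A] by auto
  then obtain j0 where j0: "j0 \<le> k" "u j0 \<noteq> 0" by blast
  define d where "d = Gcd (u ` {..k})"
  have d0: "d \<noteq> 0" using j0 by (auto simp: d_def)
  have dvd: "d dvd u j" if "j \<le> k" for j using that by (auto simp: d_def)
  define v where "v = (\<lambda>j. u j div d)"
  have uv: "u j = d * v j" if "j \<le> k" for j using dvd[OF that] by (simp add: v_def)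
  have "\<exists>j\<le>k. odd (v j)"
  proof (rule ccontr)
    assume "\<not> ?thesis"
    then have "d * 2 dvd d * v j" if "j \<le> k" for j using that by (intro mult_dvd_mono) auto
    then have "d * 2 dvd Gcd (u ` {..k})" using uv by (intro Gcd_greatest) auto
    then have "d * 2 dvd d * 1" by (simp add: d_def)
    then show False using d0 by (simp only: dvd_mult_cancel_left) simp
  qed
  moreover have "(\<Sum>j\<le>k. A i j * v j) = 0" if "i < k" for i
  proof -
    have "d * (\<Sum>j\<le>k. A i j * v j) = (\<Sum>j\<le>k. A i j * u j)"
      by (simp add: sum_distrib_left uv algebra_simps)
    then show ?thesis using sys[OF that] d0 by simp
  qed
  ultimately show ?thesis by blast
qed

section \<open>First differences of the binary digit sum\<close>

definition digit_sum_diff :: "nat \<Rightarrow> int" where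
  "digit_sum_diff n = int (s2 n) - int (s2 (n - 1))"

lemma s2_zero: "s2 0 = 0"
  by (simp add: s2.simps)

lemma s2_double: "s2 (2 * n) = s2 n"
  by (cases "n = 0") (simp_all add: s2.simps[of "2 * n"] s2_zero)

lemma s2_double_Suc: "s2 (2 * n + 1) = s2 n + 1"
  by (subst s2.simps) simp

lemma digit_sum_diff_zero: "digit_sum_diff 0 = 0"
  by (simp add: digit_sum_diff_def)

lemma digit_sum_diff_odd: "odd n \<Longrightarrow> digit_sum_diff n = 1"
  by (elim oddE) (simp add: digit_sum_diff_def s2_double s2_double_Suc[simplified])

lemma digit_sum_diff_double:
  assumes "n > 0" shows "digit_sum_diff (2 * n) = digit_sum_diff n - 1"
proof -
  have "2 * n - 1 = 2 * (n - 1) + 1" using assms by simp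
  then have "s2 (2 * n - 1) = s2 (n - 1) + 1" by (metis s2_double_Suc)
  then show ?thesis by (simp add: digit_sum_diff_def s2_double)
qed

section \<open>The generating function modulo 2\<close>

text \<open>The Frobenius identity \<open>f\<^sup>2 = f (x\<^sup>2)\<close> in characteristic 2, read off coefficientwise. It follows by
  splitting off the constant term, because the cross term of the square has the factor 2.\<close>

lemma square_fps_bit_nth:
  fixes f :: "bit fps"
  shows "fps_nth (f ^ 2) n = (if even n then fps_nth f (n div 2) else 0)"
proof (induction n arbitrary: f rule: less_induct)
  case (less n)
  have two: "(2 :: bit fps) = 0"
    by (simp add: fps_eq_iff fps_numeral_nth)
  have "f = fps_const (fps_nth f 0) + fps_X * fps_shift 1 f" (is "_ = ?c + fps_X * ?g")
    by (simp add: fps_eq_iff)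
  then have "f ^ 2 = (?c + fps_X * ?g) ^ 2" by simp
  also have "\<dots> = ?c ^ 2 + fps_X ^ 2 * ?g ^ 2 + 2 * (?c * fps_X * ?g)"
    by (simp add: power2_eq_square algebra_simps)
  finally have eq: "f ^ 2 = fps_const (fps_nth f 0 ^ 2) + fps_X ^ 2 * ?g ^ 2"
    by (simp add: two fps_const_power)
  show ?case
  proof (cases "n < 2")
    case True
    then have "n = 0 \<or> n = 1" by auto
    then show ?thesis
      by (subst eq) (auto simp: fps_X_power_mult_nth)
  next
    case False
    then obtain m where m: "n = m + 2" by (metis add.commute le_Suc_ex not_less)
    have "fps_nth (f ^ 2) n = fps_nth (?g ^ 2) m"
      by (subst eq) (simp add: m fps_X_power_mult_nth)
    also have "\<dots> = (if even m then fps_nth ?g (m div 2) else 0)"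
      by (rule less) (simp add: m)
    finally show ?thesis by (simp add: m)
  qed
qed

definition series_mod2 :: "bit fps" where
  "series_mod2 = Abs_fps (\<lambda>n. of_int (digit_sum_diff n))"

lemma of_int_bit: "(of_int n :: bit) = of_bool (odd n)"
  by (cases "even n") (auto elim!: evenE oddE)

text \<open>By Frobenius the coefficients of \<open>h\<^sup>2 + h\<close> at positive even exponents \<open>2 * m\<close> are
  \<open>a m + a (2 * m)\<close>, which is odd by the doubling rule; so \<open>h\<^sup>2 + h = x + x\<^sup>2 + x\<^sup>3 + \<dots>\<close>.\<close>

lemma series_mod2_equation:
  "(1 + fps_X) * (series_mod2 ^ 2 + series_mod2) = fps_X"
proof (rule fps_ext)
  have coeff: "fps_nth (series_mod2 ^ 2 + series_mod2) n = of_bool (n > 0)" for n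
  proof (cases "even n")
    case True
    then obtain m where "n = 2 * m" by blast
    then show ?thesis
      by (cases "m = 0")
         (auto simp: square_fps_bit_nth series_mod2_def digit_sum_diff_zero digit_sum_diff_double of_int_bit)
  next
    case False
    then show ?thesis
      by (auto simp: square_fps_bit_nth series_mod2_def digit_sum_diff_odd odd_pos)
  qed
  fix n
  show "fps_nth ((1 + fps_X) * (series_mod2 ^ 2 + series_mod2)) n = fps_nth fps_X n"
    using coeff[of n] coeff[of "n - 1"] by (cases n) (simp_all add: distrib_right)
qed

lemma bit_poly_add_self: "(p :: bit poly) + p = 0"
  by (rule poly_eqI, simp only: coeff_add coeff_0) simp

lemma bit_fps_add_self: "(f :: bit fps) + f = 0"
  by (rule fps_ext, simp only: fps_add_nth fps_zero_nth) simp

text \<open>The left-hand side is \<open>1 + x\<close> times the norm form of \<open>Q * h - P\<close>. If it vanishes and \<open>Q\<close> is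
  nonzero, then the degrees of \<open>P\<close> and \<open>P + Q\<close> add up to twice the degree of \<open>Q\<close>. This forces all
  three degrees to be equal, but over the field with two elements the leading coefficients of \<open>P\<close>
  and \<open>Q\<close> then cancel in \<open>P + Q\<close>.\<close>

lemma bit_poly_no_solution:
  fixes P Q :: "bit poly"
  assumes eq: "[:0, 1:] * Q ^ 2 + [:1, 1:] * (P * (P + Q)) = 0"
  shows "Q = 0"
proof (rule ccontr)
  assume Q: "Q \<noteq> 0"
  have eq': "[:0, 1:] * Q ^ 2 = [:1, 1:] * (P * (P + Q))"
  proof -
    have "[:0, 1:] * Q ^ 2 = [:0, 1:] * Q ^ 2 + ([:1, 1:] * (P * (P + Q)) + [:1, 1:] * (P * (P + Q)))"
      by (simp only: bit_poly_add_self add_0_right)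
    also have "\<dots> = [:1, 1:] * (P * (P + Q))"
      by (simp only: add.assoc[symmetric] eq add_0)
    finally show ?thesis .
  qed
  moreover have "[:0, 1:] * Q ^ 2 \<noteq> 0" using Q by simp
  ultimately have PQ: "P \<noteq> 0" "P + Q \<noteq> 0" by auto
  have "degree ([:0, 1:] * Q ^ 2) = 1 + 2 * degree Q"
    using Q by (subst degree_mult_eq) (auto simp: degree_power_eq)
  moreover have "degree ([:1, 1:] * (P * (P + Q))) = 1 + (degree P + degree (P + Q))"
    using PQ by (subst degree_mult_eq, simp, simp) (subst degree_mult_eq, auto)
  ultimately have deg: "2 * degree Q = degree P + degree (P + Q)"
    using eq' by (metis add_left_cancel)
  consider "degree P < degree Q" | "degree Q < degree P" | "degree P = degree Q" by linarith
  then show False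
  proof cases
    case 1
    then show False using deg degree_add_eq_right[of P Q] by simp
  next
    case 2
    then show False using deg degree_add_eq_left[of Q P] by simp
  next
    case 3
    have lead: "lead_coeff P = 1" "lead_coeff Q = 1"
      using PQ(1) Q by (metis bit_not_zero_iff leading_coeff_0_iff)+
    have "degree (P + Q) = degree P" using deg 3 by simp
    then have "lead_coeff (P + Q) = lead_coeff P + lead_coeff Q" by (simp add: 3)
    also have "\<dots> = 0" by (simp only: lead) simp
    finally show False using PQ(2) by (simp only: leading_coeff_0_iff)
  qed
qed

text \<open>The columns of the Hankel matrix \<open>a (i + j)\<close>, where \<open>1 \<le> i \<le> k + 1\<close> and \<open>0 \<le> j \<le> k\<close>, are linearly
  independent modulo 2. A dependency \<open>v\<close>, with its entries in reversed order as coefficients of a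
  polynomial \<open>Q\<close>, makes the coefficients of \<open>Q * h\<close> vanish from \<open>x ^ (k + 1)\<close> to \<open>x ^ (2 * k + 1)\<close>.\<close>

lemma hankel_nonsingular_mod2:
  assumes "j0 \<le> k" "odd (v j0)"
  shows "\<exists>i\<in>{1..k + 1}. odd (\<Sum>j\<le>k. v j * digit_sum_diff (i + j))"
proof (rule ccontr)
  assume "\<not> ?thesis"
  then have ev: "even (\<Sum>j\<le>k. v j * digit_sum_diff (i + j))" if "i \<in> {1..k + 1}" for i
    using that by blast
  define Q where "Q = Poly (map (\<lambda>n. of_int (v (k - n)) :: bit) [0..<Suc k])"
  have coeff_Q: "coeff Q n = (if n \<le> k then of_int (v (k - n)) else 0)" for n
    by (auto simp: Q_def coeff_Poly_eq nth_default_def less_Suc_eq_le simp del: upt_Suc)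
  define H where "H = fps_of_poly Q * series_mod2"
  define P where "P = Poly (map (fps_nth H) [0..<Suc k])"
  have coeff_P: "coeff P n = (if n \<le> k then fps_nth H n else 0)" for n
    by (auto simp: P_def coeff_Poly_eq nth_default_def less_Suc_eq_le simp del: upt_Suc)
  have H_gap: "fps_nth H n = 0" if "k < n" "n < 2 * k + 2" for n
  proof -
    define i where "i = n - k"
    have i: "i \<in> {1..k + 1}" "n = k + i" using that by (auto simp: i_def)
    have "fps_nth H n = (\<Sum>m = 0..n. coeff Q m * of_int (digit_sum_diff (n - m)))"
      by (simp add: H_def fps_mult_nth series_mod2_def)
    also have "\<dots> = (\<Sum>m\<le>k. of_int (v (k - m) * digit_sum_diff (n - m)))"
      using that by (intro sum.mono_neutral_cong_right) (auto simp: coeff_Q)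
    also have "\<dots> = (\<Sum>j\<le>k. of_int (v j * digit_sum_diff (i + j)))"
      by (rule sum.reindex_bij_witness[of _ "\<lambda>j. k - j" "\<lambda>j. k - j"]) (auto simp: i add.commute)
    also have "\<dots> = of_int (\<Sum>j\<le>k. v j * digit_sum_diff (i + j))" by simp
    also have "\<dots> = 0" using ev[OF i(1)] by (simp only: of_int_bit) simp
    finally show ?thesis .
  qed
  define M where "M = 2 * k + 2"
  then have "k < M" by simp
  define R where "R = fps_shift M H"
  have H: "H = fps_of_poly P + fps_X ^ M * R"
    using \<open>k < M\<close> by (intro fps_ext) (auto simp: coeff_P R_def fps_X_power_mult_nth M_def[symmetric] H_gap[folded M_def])
  \<comment> \<open>The norm form of \<open>Q * h - P\<close>, multiplied by \<open>1 + x\<close>; signs are immaterial.\<close>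
  define T where "T = [:0, 1:] * Q ^ 2 + [:1, 1:] * (P * (P + Q))"
  let ?q = "fps_of_poly Q" and ?p = "fps_of_poly P" and ?r = "fps_X ^ M * R"
  have "fps_of_poly T = fps_X * ?q ^ 2 + (1 + fps_X) * (?p * (?p + ?q))"
    by (simp add: T_def fps_of_poly_add fps_of_poly_mult fps_of_poly_power fps_of_poly_pCons)
  also have "fps_X * ?q ^ 2 = (1 + fps_X) * (H ^ 2 + H * ?q)"
    by (subst series_mod2_equation[symmetric]) (simp add: H_def power2_eq_square algebra_simps)
  \<comment> \<open>Both factors of the norm form appear on the right: \<open>?r\<close> is \<open>Q * h - P\<close>, and \<open>?r + ?q\<close> its conjugate.\<close>
  also have "(1 + fps_X) * (H ^ 2 + H * ?q) + (1 + fps_X) * (?p * (?p + ?q)) =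
      (1 + fps_X) * (?r * (?r + ?q)) + (1 + fps_X) * ((?p * ?p + ?p * ?p) + (?p * ?q + ?p * ?q) + (?p * ?r + ?p * ?r))"
    by (subst H)+ (simp only: power2_eq_square ring_distribs ac_simps)
  also have "\<dots> = fps_X ^ M * ((1 + fps_X) * (R * (?r + ?q)))"
    by (simp only: bit_fps_add_self add_0_right mult_zero_right) (simp only: ac_simps)
  finally have low: "coeff T n = 0" if "n < M" for n
    using that fps_of_poly_nth[of T n] by (simp add: fps_X_power_mult_nth)
  have degQ: "degree Q \<le> k" and degP: "degree P \<le> k"
    by (intro degree_le; simp add: coeff_Q coeff_P)+
  have "degree T \<le> 2 * k + 1"
    unfolding T_def
  proof (intro degree_add_le)
    have "degree (Q ^ 2) \<le> 2 * k" using degree_power_le[of Q 2] degQ by simp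
    then show "degree ([:0, 1:] * Q ^ 2) \<le> 2 * k + 1"
      using degree_mult_le[of "[:0, 1:]" "Q ^ 2"] by simp
    have "degree (P + Q) \<le> k" using degP degQ by (intro degree_add_le)
    then have "degree (P * (P + Q)) \<le> 2 * k"
      using degree_mult_le[of P "P + Q"] degP by simp
    then show "degree ([:1, 1:] * (P * (P + Q))) \<le> 2 * k + 1"
      using degree_mult_le[of "[:1, 1:]" "P * (P + Q)"] by simp
  qed
  then have "T = 0"
    by (intro poly_eqI) (metis low coeff_0 coeff_eq_0 le_less_trans not_less Suc_le_eq M_def
        add_2_eq_Suc' Suc_eq_plus1)
  then have "Q = 0" unfolding T_def by (rule bit_poly_no_solution)
  moreover have "coeff Q (k - j0) = 1" using assms by (simp add: coeff_Q of_int_bit)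
  ultimately show False by simp
qed

section \<open>The Mahler function\<close>

definition diff_series :: "real \<Rightarrow> real" where
  "diff_series x = (\<Sum>n. real_of_int (digit_sum_diff n) * x ^ n)"

lemma digit_sum_diff_bound: "\<bar>digit_sum_diff n\<bar> \<le> int (Suc n)"
  using s2_le[of n] s2_le[of "n - 1"] by (auto simp: digit_sum_diff_def)

lemma summable_diff_series:
  fixes x :: real
  assumes "\<bar>x\<bar> < 1"
  shows "summable (\<lambda>n. real_of_int (digit_sum_diff n) * x ^ n)"
proof (rule summable_comparison_test')
  show "summable (\<lambda>n. of_nat (Suc n) * \<bar>x\<bar> ^ n)"
    using geometric_deriv_sums[of "\<bar>x\<bar>"] assms by (auto simp: sums_iff)
  fix n :: nat
  have "\<bar>real_of_int (digit_sum_diff n)\<bar> \<le> real (Suc n)"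
    using digit_sum_diff_bound[of n] by linarith
  then show "norm (real_of_int (digit_sum_diff n) * x ^ n) \<le> of_nat (Suc n) * \<bar>x\<bar> ^ n"
    by (simp add: abs_mult power_abs mult_right_mono del: of_nat_Suc)
qed

lemma diff_series_sums:
  assumes "\<bar>x\<bar> < 1"
  shows "(\<lambda>n. real_of_int (digit_sum_diff n) * x ^ n) sums diff_series x"
  unfolding diff_series_def using summable_diff_series[OF assms] by (rule summable_sums)

text \<open>Grouping the terms with exponents \<open>2 * n\<close> and \<open>2 * n + 1\<close>: the even ones give
  \<open>g (x\<^sup>2) - x\<^sup>2 / (1 - x\<^sup>2)\<close>, the odd ones \<open>x / (1 - x\<^sup>2)\<close>.\<close>

lemma diff_series_functional_equation:
  assumes x: "\<bar>x\<bar> < 1"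
  shows "diff_series x = diff_series (x ^ 2) + x / (1 + x)"
proof -
  let ?a = "\<lambda>n. real_of_int (digit_sum_diff n)"
  have x2: "\<bar>x ^ 2\<bar> < 1" using x by (simp add: power_abs power_less_one_iff abs_square_less_1)
  have geo: "(\<lambda>n. (x ^ 2) ^ n) sums (1 / (1 - x ^ 2))"
    using x2 by (intro geometric_sums) simp
  have "(\<lambda>n. \<Sum>i = n * 2..<n * 2 + 2. ?a i * x ^ i) sums diff_series x"
    by (intro sums_group diff_series_sums x) simp
  moreover have "(\<Sum>i = n * 2..<n * 2 + 2. ?a i * x ^ i) =
      ?a n * (x ^ 2) ^ n + x * (x ^ 2) ^ n - ((x ^ 2) ^ n - of_bool (n = 0))" for n
  proof -
    have "{n * 2..<n * 2 + 2} = {2 * n, 2 * n + 1}" by auto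
    then have "(\<Sum>i = n * 2..<n * 2 + 2. ?a i * x ^ i) =
        ?a (2 * n) * x ^ (2 * n) + ?a (2 * n + 1) * x ^ (2 * n + 1)"
      by simp
    also have "\<dots> = ?a (2 * n) * (x ^ 2) ^ n + x * (x ^ 2) ^ n"
      by (simp add: digit_sum_diff_odd power_mult)
    also have "?a (2 * n) = ?a n - of_bool (n > 0)"
      by (cases "n = 0") (simp_all add: digit_sum_diff_double)
    finally show ?thesis by (cases "n = 0") (simp_all add: algebra_simps)
  qed
  ultimately have "(\<lambda>n. ?a n * (x ^ 2) ^ n + x * (x ^ 2) ^ n - ((x ^ 2) ^ n - of_bool (n = 0)))
      sums diff_series x" by simp
  moreover have "(\<lambda>n. ?a n * (x ^ 2) ^ n + x * (x ^ 2) ^ n - ((x ^ 2) ^ n - of_bool (n = 0)))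
      sums (diff_series (x ^ 2) + x * (1 / (1 - x ^ 2)) - (1 / (1 - x ^ 2) - 1))"
    using sums_single[of 0 "\<lambda>_. 1 :: real"]
    by (intro sums_add sums_diff sums_mult geo diff_series_sums x2) (simp add: of_bool_def)
  ultimately have "diff_series x =
      diff_series (x ^ 2) + x * (1 / (1 - x ^ 2)) - (1 / (1 - x ^ 2) - 1)"
    by (rule sums_unique2)
  moreover have "x * (1 / (1 - x ^ 2)) - (1 / (1 - x ^ 2) - 1) = x / (1 + x)"
  proof -
    have "1 - x ^ 2 = (1 - x) * (1 + x)" by (simp add: power2_eq_square algebra_simps)
    moreover have "1 - x \<noteq> 0" "1 + x \<noteq> 0" using x by auto
    ultimately show ?thesis by (simp add: divide_simps) (simp add: algebra_simps)
  qed
  ultimately show ?thesis by linarith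
qed

lemma digit_sum_series_eq:
  fixes b :: int
  assumes "b \<ge> 2"
  shows "(real_of_int b - 1) * (\<Sum>n. real (s2 n) / real_of_int b ^ n) =
    real_of_int b * diff_series (1 / real_of_int b)"
proof -
  let ?z = "1 / real_of_int b"
  let ?f = "\<lambda>n. real (s2 n) * ?z ^ n" and ?s = "\<Sum>n. real (s2 n) / real_of_int b ^ n"
  have f: "?f sums ?s"
    using summable_sums[OF summable_s2[OF assms]] by (simp add: power_one_over)
  have "(\<lambda>n. ?z * ?f n) sums (?z * ?s)" using f by (rule sums_mult)
  then have "(\<lambda>n. real (s2 (Suc n - 1)) * ?z ^ Suc n) sums (?z * ?s)" by (simp add: ac_simps)
  then have "(\<lambda>n. real (s2 (n - 1)) * ?z ^ n) sums (?z * ?s)"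
    by (subst (asm) sums_Suc_iff) (simp add: s2_zero)
  from sums_diff[OF f this]
  have "(\<lambda>n. real_of_int (digit_sum_diff n) * ?z ^ n) sums (?s - ?z * ?s)"
    by (simp add: digit_sum_diff_def algebra_simps)
  moreover have "\<bar>?z\<bar> < 1" using assms by simp
  ultimately have "diff_series ?z = ?s - ?z * ?s"
    using diff_series_sums sums_unique2 by blast
  then show ?thesis using assms by (simp add: field_simps)
qed

text \<open>Iterating the functional equation adds the fractions \<open>1 / (b ^ 2 ^ i + 1)\<close> for \<open>i < m\<close>. Because
  \<open>y\<^sup>2 - 1 = (y - 1) * (y + 1)\<close>, they have the common denominator \<open>b ^ 2 ^ m - 1\<close>, which is far smaller
  than a high power of \<open>b ^ 2 ^ m\<close>; so clearing it hardly worsens an approximation.\<close>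

lemma diff_series_tower:
  fixes b :: int
  assumes b: "b \<ge> 2"
  shows "\<exists>A :: int. (real_of_int b ^ 2 ^ m - 1) *
    (diff_series (1 / real_of_int b) - diff_series (1 / real_of_int b ^ 2 ^ m)) = real_of_int A"
proof (induction m)
  case 0
  then show ?case by (auto intro: exI[of _ 0])
next
  case (Suc m)
  let ?y = "real_of_int b ^ 2 ^ m" and ?g = diff_series
  let ?d = "?g (1 / real_of_int b) - ?g (1 / ?y)"
  obtain A :: int where A: "(?y - 1) * ?d = A" using Suc by blast
  have y: "?y > 1" using b by simp
  have y2: "real_of_int b ^ 2 ^ Suc m = ?y ^ 2" by (simp flip: power_mult add: mult.commute)
  have "?g (1 / ?y) = ?g (1 / ?y ^ 2) + (1 / ?y) / (1 + 1 / ?y)"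
    using y diff_series_functional_equation[of "1 / ?y"] by (simp add: power_divide)
  moreover have "(1 / ?y) / (1 + 1 / ?y) = 1 / (?y + 1)" using y b by (simp add: field_simps)
  ultimately have g: "?g (1 / ?y ^ 2) = ?g (1 / ?y) - 1 / (?y + 1)" by linarith
  have "(?y ^ 2 - 1) * (?g (1 / real_of_int b) - ?g (1 / ?y ^ 2)) =
      (?y + 1) * ((?y - 1) * ?d) + (?y - 1) * ((?y + 1) * (1 / (?y + 1)))"
    unfolding g by (simp only: power2_eq_square ring_distribs ac_simps)
  also have "\<dots> = (?y + 1) * A + (?y - 1)" using A y by simp
  also have "\<dots> = real_of_int ((b ^ 2 ^ m + 1) * A + (b ^ 2 ^ m - 1))" by simp
  finally show ?case unfolding y2 by blast
qed

section \<open>Pade approximation and specialization\<close>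

text \<open>The coefficients \<open>v\<close> of \<open>Q\<close> solve the \<open>k\<close> linear equations saying that the expansion of
  \<open>Q y * g (1 / y)\<close> in \<open>1 / y\<close> has no term of exponent \<open>1, \<dots>, k\<close>. The coefficient \<open>c\<close> of exponent
  \<open>k + 1\<close> is then odd, since \<open>v\<close> would otherwise be in the kernel of the Hankel matrix modulo 2. The
  function \<open>\<rho>\<close> is the remainder, normalized to have the limit \<open>c\<close>.\<close>

lemma pade_form_exists:
  obtains v :: "nat \<Rightarrow> int" and \<rho> :: "real \<Rightarrow> real" and c :: int
  where "c \<noteq> 0" "(\<rho> \<longlongrightarrow> of_int c) (at 0)"
    "\<And>y :: int. y > 1 \<Longrightarrow> \<exists>P :: int. (\<Sum>j\<le>k. of_int (v j) * of_int y ^ j) * diff_series (1 / of_int y) - of_int P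
        = \<rho> (1 / of_int y) / of_int y ^ (k + 1)"
proof -
  let ?a = digit_sum_diff
  obtain v where v: "\<exists>j\<le>k. odd (v j)" and sys: "\<And>i. i < k \<Longrightarrow> (\<Sum>j\<le>k. ?a (i + 1 + j) * v j) = 0"
    using exists_kernel_vector_with_odd_entry[of k "\<lambda>i j. ?a (i + 1 + j)"] by blast
  \<comment> \<open>The coefficient of \<open>y ^ -i\<close> in \<open>Q y * g (1 / y)\<close>.\<close>
  define r where "r = (\<lambda>i. \<Sum>j\<le>k. v j * ?a (i + j))"
  have r0: "r (Suc i) = 0" if "i < k" for i
    using sys[OF that] by (simp add: r_def mult.commute)
  obtain i where "i \<in> {1..k + 1}" "odd (r i)"
    using v hankel_nonsingular_mod2[of _ k v] unfolding r_def by blast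
  moreover from this r0[of "i - 1"] have "i = k + 1"
    by (cases "i = k + 1") auto
  ultimately have c: "r (k + 1) \<noteq> 0" by auto
  define \<rho> where "\<rho> = (\<lambda>x :: real. \<Sum>i. of_int (r (i + k + 1)) * x ^ i)"
  have tail: "(\<lambda>i. of_int (v j * ?a (i + Suc j)) * x ^ i * x ^ Suc j) sums
      (of_int (v j) * (diff_series x - (\<Sum>n<Suc j. of_int (?a n) * x ^ n)))"
    if "\<bar>x\<bar> < 1" for x :: real and j
    using sums_mult[OF sums_split_initial_segment[OF diff_series_sums[OF that], of "Suc j"], of "of_int (v j)"]
    by (simp add: power_add ac_simps)
  have rsums: "(\<lambda>i. of_int (r (Suc i)) * x ^ i) sums
      (\<Sum>j\<le>k. of_int (v j) * (diff_series x - (\<Sum>n<Suc j. of_int (?a n) * x ^ n)) / x ^ Suc j)"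
    if "\<bar>x\<bar> < 1" "x \<noteq> 0" for x :: real
  proof -
    have "(\<lambda>i. \<Sum>j\<le>k. of_int (v j * ?a (i + Suc j)) * x ^ i * x ^ Suc j / x ^ Suc j) sums
      (\<Sum>j\<le>k. of_int (v j) * (diff_series x - (\<Sum>n<Suc j. of_int (?a n) * x ^ n)) / x ^ Suc j)"
      by (intro sums_sum sums_divide tail that)
    then show ?thesis using that(2) by (simp add: r_def sum_distrib_right)
  qed
  have rho_sums: "(\<lambda>i. of_int (r (i + k + 1)) * x ^ i) sums \<rho> x" if "\<bar>x\<bar> < 1" for x :: real
  proof (cases "x = 0")
    case True
    then show ?thesis unfolding \<rho>_def by (intro summable_sums) simp
  next
    case False
    have "summable (\<lambda>i. of_int (r (Suc (i + k))) * x ^ (i + k))"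
      using rsums[OF that False] by (intro summable_ignore_initial_segment) (auto simp: sums_iff)
    then have "summable (\<lambda>i. of_int (r (Suc (i + k))) * x ^ (i + k) / x ^ k)"
      by (rule summable_divide)
    then show ?thesis unfolding \<rho>_def using False by (intro summable_sums) (simp add: power_add)
  qed
  have lim: "(\<rho> \<longlongrightarrow> of_int (r (k + 1))) (at 0)"
    using powser_limit_0[of 1 "\<lambda>i. of_int (r (i + k + 1)) :: real" \<rho>] rho_sums by simp
  have "\<exists>P :: int. (\<Sum>j\<le>k. of_int (v j) * of_int y ^ j) * diff_series (1 / of_int y) - of_int P
        = \<rho> (1 / of_int y) / of_int y ^ (k + 1)" if "y > 1" for y :: int
  proof -
    let ?x = "1 / real_of_int y"
    have x: "\<bar>?x\<bar> < 1" "?x \<noteq> 0" using that by auto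
    have "(\<lambda>i. of_int (r (Suc (i + k))) * ?x ^ (i + k)) sums (\<rho> ?x * ?x ^ k)"
      using sums_mult2[OF rho_sums[OF x(1)], of "?x ^ k"] by (simp add: power_add mult.assoc)
    then have "(\<lambda>i. of_int (r (Suc i)) * ?x ^ i) sums (\<rho> ?x * ?x ^ k)"
      using sums_zero_iff_shift[of k "\<lambda>i. of_int (r (Suc i)) * ?x ^ i"] by (simp add: r0)
    then have "\<rho> ?x * ?x ^ k = (\<Sum>j\<le>k. of_int (v j) * (diff_series ?x - (\<Sum>n<Suc j. of_int (?a n) * ?x ^ n)) / ?x ^ Suc j)"
      using rsums[OF x] by (rule sums_unique2)
    then have "?x * (\<rho> ?x * ?x ^ k) = ?x * (\<Sum>j\<le>k. of_int (v j) * (diff_series ?x - (\<Sum>n<Suc j. of_int (?a n) * ?x ^ n)) / ?x ^ Suc j)"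
      by simp
    also have "\<dots> = (\<Sum>j\<le>k. of_int (v j) * of_int y ^ j * (diff_series ?x - (\<Sum>n<Suc j. of_int (?a n) * ?x ^ n)))"
      unfolding sum_distrib_left using that by (intro sum.cong) (auto simp: field_simps)
    also have "\<dots> = (\<Sum>j\<le>k. of_int (v j) * of_int y ^ j) * diff_series ?x -
        (\<Sum>j\<le>k. of_int (v j) * (of_int y ^ j * (\<Sum>n<Suc j. of_int (?a n) * ?x ^ n)))"
      by (simp add: right_diff_distrib sum_subtractf sum_distrib_right mult.assoc del: sum.lessThan_Suc)
    \<comment> \<open>The polynomial part is an integer, because only \<open>n \<le> j\<close> occurs.\<close>
    also have "(\<Sum>j\<le>k. of_int (v j) * (of_int y ^ j * (\<Sum>n<Suc j. of_int (?a n) * ?x ^ n))) =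
        of_int (\<Sum>j\<le>k. v j * (\<Sum>n<Suc j. ?a n * y ^ (j - n)))"
    proof -
      have "real_of_int y ^ j * (of_int (?a n) * ?x ^ n) = of_int (?a n * y ^ (j - n))" if "n < Suc j" for n j
      proof -
        have "real_of_int y ^ j = of_int y ^ (j - n) * of_int y ^ n" using that by (simp flip: power_add)
        then show ?thesis using \<open>y > 1\<close> by (simp add: power_one_over)
      qed
      then have "real_of_int y ^ j * (\<Sum>n<Suc j. of_int (?a n) * ?x ^ n) = of_int (\<Sum>n<Suc j. ?a n * y ^ (j - n))" for j
        unfolding sum_distrib_left of_int_sum by (intro sum.cong) auto
      then show ?thesis by (simp del: sum.lessThan_Suc)
    qed
    finally show ?thesis
      by (intro exI[of _ "\<Sum>j\<le>k. v j * (\<Sum>n<Suc j. ?a n * y ^ (j - n))"])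
         (simp add: power_one_over del: sum.lessThan_Suc)
  qed
  then show ?thesis using that c lim by blast
qed

text \<open>The Pade form at \<open>Y = b ^ 2 ^ m\<close> is carried over to \<open>\<alpha>\<close> by multiplying it with \<open>Y - 1\<close>. This costs a
  factor \<open>Y\<close> on both sides: \<open>q\<close> is of size \<open>Y ^ (k + 1)\<close> instead of \<open>Y ^ k\<close>, and \<open>q * \<alpha> - p\<close> of size
  \<open>Y ^ -k\<close> instead of \<open>Y ^ -(k + 1)\<close>. For each \<open>k\<close> one constant serves all large \<open>m\<close>.\<close>

lemma good_approximations:
  fixes b :: int
  assumes b: "b \<ge> 2"
  defines "\<alpha> \<equiv> \<Sum>n. real (s2 n) / real_of_int b ^ n"
  shows "\<exists>C\<ge>1. \<forall>\<^sub>F m in sequentially. \<exists>p q :: int.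
    \<bar>of_int q\<bar> \<le> C * (of_int b ^ 2 ^ m) ^ (k + 1) \<and>
    1 \<le> C * ((of_int b ^ 2 ^ m) ^ k * \<bar>of_int q * \<alpha> - of_int p\<bar>) \<and>
    (of_int b ^ 2 ^ m) ^ k * \<bar>of_int q * \<alpha> - of_int p\<bar> \<le> C"
proof -
  obtain v :: "nat \<Rightarrow> int" and \<rho> and c :: int where c: "c \<noteq> 0"
    and lim: "(\<rho> \<longlongrightarrow> of_int c) (at (0 :: real))"
    and form: "\<And>y :: int. y > 1 \<Longrightarrow> \<exists>P :: int. (\<Sum>j\<le>k. of_int (v j) * of_int y ^ j) * diff_series (1 / of_int y) - of_int P
        = \<rho> (1 / of_int y) / of_int y ^ (k + 1)"
    by (rule pade_form_exists[of k]) blast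
  let ?V = "\<Sum>j\<le>k. \<bar>real_of_int (v j)\<bar>"
  let ?B = "real_of_int b"
  have B: "?B \<ge> 2" using b by linarith
  define C where "C = ?B * (\<bar>of_int c\<bar> + 1) + ?B * ?V + 2"
  have V: "0 \<le> ?B * ?V" using B by (intro mult_nonneg_nonneg sum_nonneg) auto
  have C1: "?B * (\<bar>of_int c\<bar> + 1) \<le> C" "?B * ?V \<le> C" "2 \<le> C"
    using V B by (auto simp: C_def)
  have pow: "filterlim (\<lambda>m::nat. (2::nat) ^ m) at_top sequentially"
    by (rule filterlim_subseq) (simp add: strict_mono_def)
  have "(\<lambda>n. (1 / ?B) ^ n) \<longlonglongrightarrow> 0"
    using B by (intro LIMSEQ_power_zero) auto
  then have "(\<lambda>m. (1 / ?B) ^ 2 ^ m) \<longlonglongrightarrow> 0"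
    by (rule filterlim_compose[OF _ pow])
  then have "(\<lambda>m. 1 / ?B ^ 2 ^ m) \<longlonglongrightarrow> 0" by (simp add: power_one_over)
  then have "filterlim (\<lambda>m. 1 / ?B ^ 2 ^ m) (at 0) sequentially"
    using B by (auto simp: filterlim_at)
  then have "(\<lambda>m. \<rho> (1 / ?B ^ 2 ^ m)) \<longlonglongrightarrow> of_int c"
    by (rule filterlim_compose[OF lim])
  then have "\<forall>\<^sub>F m in sequentially. dist (\<rho> (1 / ?B ^ 2 ^ m)) (of_int c) < 1 / 2"
    by (rule tendstoD) simp
  then have "\<forall>\<^sub>F m in sequentially. \<exists>p q :: int.
    \<bar>of_int q\<bar> \<le> C * (?B ^ 2 ^ m) ^ (k + 1) \<and>
    1 \<le> C * ((?B ^ 2 ^ m) ^ k * \<bar>of_int q * \<alpha> - of_int p\<bar>) \<and>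
    (?B ^ 2 ^ m) ^ k * \<bar>of_int q * \<alpha> - of_int p\<bar> \<le> C"
  proof eventually_elim
    case (elim m)
    define y where "y = b ^ 2 ^ m"
    define Y where "Y = real_of_int y"
    have Y: "?B ^ 2 ^ m = Y" by (simp add: Y_def y_def)
    have "?B ^ 1 \<le> ?B ^ 2 ^ m" using B by (intro power_increasing) auto
    then have Y2: "Y \<ge> 2" using B Y by simp
    then have y1: "y > 1" by (simp add: Y_def)
    define Q where "Q = (\<Sum>j\<le>k. v j * y ^ j)"
    obtain P :: int where P: "of_int Q * diff_series (1 / Y) - of_int P = \<rho> (1 / Y) / Y ^ (k + 1)"
      using form[OF y1] by (auto simp: Q_def Y_def)
    obtain A :: int where A: "(Y - 1) * (diff_series (1 / ?B) - diff_series (1 / Y)) = of_int A"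
      using diff_series_tower[OF b, of m] Y by auto
    \<comment> \<open>The factor \<open>b - 1\<close> is there because \<open>(b - 1) * \<alpha> = b * g (1 / b)\<close>.\<close>
    define q where "q = (b - 1) * (y - 1) * Q"
    define p where "p = b * (Q * A + (y - 1) * P)"
    have "of_int q * \<alpha> = (Y - 1) * of_int Q * ((?B - 1) * \<alpha>)"
      by (simp add: q_def Y_def ac_simps)
    also have "(?B - 1) * \<alpha> = ?B * diff_series (1 / ?B)"
      unfolding \<alpha>_def by (rule digit_sum_series_eq[OF b])
    also have "(Y - 1) * of_int Q * (?B * diff_series (1 / ?B)) - of_int p =
        ?B * (of_int Q * ((Y - 1) * (diff_series (1 / ?B) - diff_series (1 / Y)) - of_int A) +
          (Y - 1) * (of_int Q * diff_series (1 / Y) - of_int P))"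
      by (simp add: p_def Y_def algebra_simps)
    also have "\<dots> = ?B * (Y - 1) * (\<rho> (1 / Y) / Y ^ (k + 1))" by (simp add: A P)
    finally have err: "of_int q * \<alpha> - of_int p = ?B * (Y - 1) * (\<rho> (1 / Y) / Y ^ (k + 1))" .
    have size: "Y ^ k * \<bar>of_int q * \<alpha> - of_int p\<bar> = ?B * ((Y - 1) / Y) * \<bar>\<rho> (1 / Y)\<bar>"
    proof -
      have "\<bar>?B * (Y - 1) * (\<rho> (1 / Y) / Y ^ (k + 1))\<bar> = ?B * (Y - 1) * (\<bar>\<rho> (1 / Y)\<bar> / Y ^ (k + 1))"
        using Y2 B by (simp add: abs_mult)
      then show ?thesis unfolding err using Y2 by (simp add: field_simps)
    qed
    have ratio: "1 / 2 \<le> (Y - 1) / Y" "(Y - 1) / Y \<le> 1" using Y2 by (auto simp: field_simps)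
    have rho: "\<bar>\<rho> (1 / Y)\<bar> \<ge> 1 / 2" "\<bar>\<rho> (1 / Y)\<bar> \<le> \<bar>of_int c\<bar> + 1"
    proof -
      have "\<bar>real_of_int c\<bar> \<ge> 1" using c by linarith
      then show "\<bar>\<rho> (1 / Y)\<bar> \<ge> 1 / 2" "\<bar>\<rho> (1 / Y)\<bar> \<le> \<bar>of_int c\<bar> + 1"
        using elim unfolding Y dist_real_def by linarith+
    qed
    have lower: "2 * (1 / 2) * (1 / 2) \<le> Y ^ k * \<bar>of_int q * \<alpha> - of_int p\<bar>"
      unfolding size using B Y2 by (intro mult_mono ratio rho) auto
    have upper: "Y ^ k * \<bar>of_int q * \<alpha> - of_int p\<bar> \<le> ?B * 1 * (\<bar>of_int c\<bar> + 1)"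
      unfolding size using B Y2 by (intro mult_mono ratio rho) auto
    have "\<bar>real_of_int Q\<bar> \<le> (\<Sum>j\<le>k. \<bar>of_int (v j) * Y ^ j\<bar>)"
      unfolding Q_def Y_def by (simp add: sum_abs)
    also have "\<dots> \<le> (\<Sum>j\<le>k. \<bar>of_int (v j)\<bar> * Y ^ k)"
      using Y2 by (intro sum_mono) (simp add: abs_mult mult_left_mono power_increasing)
    finally have "\<bar>real_of_int Q\<bar> \<le> ?V * Y ^ k" by (simp add: sum_distrib_right)
    then have "(?B - 1) * (Y - 1) * \<bar>of_int Q\<bar> \<le> ?B * Y * (?V * Y ^ k)"
      using B Y2 by (intro mult_mono) auto
    also have "\<dots> = (?B * ?V) * Y ^ (k + 1)" by simp
    also have "\<dots> \<le> C * Y ^ (k + 1)" using C1(2) Y2 by (intro mult_right_mono) auto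
    finally have "\<bar>of_int q\<bar> \<le> C * Y ^ (k + 1)"
      using B Y2 by (simp add: q_def abs_mult Y_def)
    moreover have "2 * (1 / 2) \<le> C * (Y ^ k * \<bar>of_int q * \<alpha> - of_int p\<bar>)"
      using lower C1(3) by (intro mult_mono) auto
    ultimately have "\<bar>of_int q\<bar> \<le> C * Y ^ (k + 1) \<and> 1 \<le> C * (Y ^ k * \<bar>of_int q * \<alpha> - of_int p\<bar>) \<and>
        Y ^ k * \<bar>of_int q * \<alpha> - of_int p\<bar> \<le> C"
      using upper C1(1) by linarith
    then show ?case unfolding Y by blast
  qed
  then show ?thesis using C1(3) by (intro exI[of _ C]) auto
qed

section \<open>From good approximations to the irrationality exponent\<close>

text \<open>A solution \<open>p / q\<close> is compared with the first approximation \<open>p' / q'\<close> that is fine enough for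
  \<open>q * \<bar>q' * \<alpha> - p'\<bar> \<le> 1 / 2\<close>. If the two fractions differ, then \<open>\<bar>q * p' - q' * p\<bar> \<ge> 1\<close> bounds
  \<open>\<bar>q * \<alpha> - p\<bar>\<close> from below by \<open>1 / (2 * \<bar>q'\<bar>)\<close>. If they are equal, the lower bound for
  \<open>\<bar>q' * \<alpha> - p'\<bar>\<close> takes its place. Write \<open>y = \<beta> ^ 2 ^ m\<close>. The choice of \<open>k\<close> as minimal makes
  \<open>y ^ (k - 1)\<close> at most a multiple of \<open>q\<close>, and the exponents \<open>k\<close> and \<open>k + 1\<close> in the bounds exceed
  \<open>k - 1\<close> so little that the total loss is at most \<open>y ^ 3\<close>. As \<open>k > K\<close>, this is at most a multiple of
  \<open>q powr (3 / K)\<close>.\<close>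

lemma finite_solutions_of_good_approximations:
  fixes \<alpha> \<beta> \<mu> :: real
  assumes \<beta>: "\<beta> > 1" and \<mu>: "\<mu> > 2"
    and good: "\<And>k. \<exists>C\<ge>1. \<forall>\<^sub>F m in sequentially. \<exists>p q :: int.
      \<bar>of_int q\<bar> \<le> C * (\<beta> ^ 2 ^ m) ^ (k + 1) \<and>
      1 \<le> C * ((\<beta> ^ 2 ^ m) ^ k * \<bar>of_int q * \<alpha> - of_int p\<bar>) \<and>
      (\<beta> ^ 2 ^ m) ^ k * \<bar>of_int q * \<alpha> - of_int p\<bar> \<le> C"
  shows "finite {(p :: int, q :: nat). q > 0 \<and> \<bar>\<alpha> - of_int p / real q\<bar> < 1 / real q powr \<mu>}"
proof -
  let ?S = "{(p :: int, q :: nat). q > 0 \<and> \<bar>\<alpha> - of_int p / real q\<bar> < 1 / real q powr \<mu>}"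
  let ?y = "\<lambda>m. \<beta> ^ 2 ^ m"
  define good_at where "good_at = (\<lambda>C k m. \<exists>p q :: int. \<bar>of_int q\<bar> \<le> C * ?y m ^ (k + 1) \<and>
      1 \<le> C * (?y m ^ k * \<bar>of_int q * \<alpha> - of_int p\<bar>) \<and>
      ?y m ^ k * \<bar>of_int q * \<alpha> - of_int p\<bar> \<le> C)"
  have "\<exists>C\<ge>1. \<forall>\<^sub>F m in sequentially. good_at C k m" for k
    unfolding good_at_def by (rule good)
  then obtain C0 where C0: "\<And>k. C0 k \<ge> 1" "\<And>k. \<forall>\<^sub>F m in sequentially. good_at (C0 k) k m"
    by metis
  have y1: "?y m > 1" for m using \<beta> by simp
  obtain K :: nat where K: "K > 3 / (\<mu> - 2)" using reals_Archimedean2 by blast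
  moreover have "3 / (\<mu> - 2) > 0" using \<mu> by simp
  ultimately have K0: "real K > 0" by linarith
  \<comment> \<open>The comparison bounds \<open>q powr \<mu>\<close> by a constant times \<open>q powr (2 + 3 / K)\<close>, hence \<open>q powr \<epsilon>\<close> by a constant.\<close>
  define \<epsilon> where "\<epsilon> = \<mu> - 2 - 3 / real K"
  have \<epsilon>: "\<epsilon> > 0" using K K0 \<mu> by (simp add: \<epsilon>_def field_simps)
  define C where "C = (\<Sum>k\<le>2 * K. C0 k)"
  have C0_le: "C0 k \<le> C" if "k \<le> 2 * K" for k
    unfolding C_def using that C0(1) by (intro member_le_sum) (auto intro: order_trans[of 0 1])
  have C1: "C \<ge> 1" using C0_le[of 0] C0(1)[of 0] by simp
  have "\<forall>\<^sub>F m in sequentially. \<forall>k\<in>{..2 * K}. good_at C k m"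
  proof (rule eventually_ball_finite, simp, rule ballI)
    fix k assume k: "k \<in> {..2 * K}"
    from C0(2)[of k] show "\<forall>\<^sub>F m in sequentially. good_at C k m"
    proof eventually_elim
      case (elim m)
      then obtain p q :: int where *: "\<bar>of_int q\<bar> \<le> C0 k * ?y m ^ (k + 1)"
        "1 \<le> C0 k * (?y m ^ k * \<bar>of_int q * \<alpha> - of_int p\<bar>)"
        "?y m ^ k * \<bar>of_int q * \<alpha> - of_int p\<bar> \<le> C0 k" unfolding good_at_def by blast
      have le: "C0 k \<le> C" using C0_le k by simp
      have "0 \<le> ?y m ^ k * \<bar>of_int q * \<alpha> - of_int p\<bar>" "0 \<le> ?y m ^ (k + 1)" using y1[of m] by auto
      from mult_right_mono[OF le this(1)] mult_right_mono[OF le this(2)] * le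
      have "\<bar>of_int q\<bar> \<le> C * ?y m ^ (k + 1) \<and> 1 \<le> C * (?y m ^ k * \<bar>of_int q * \<alpha> - of_int p\<bar>) \<and>
          ?y m ^ k * \<bar>of_int q * \<alpha> - of_int p\<bar> \<le> C" by linarith
      then show ?case unfolding good_at_def by blast
    qed
  qed
  then obtain M where M: "\<And>m k. m \<ge> M \<Longrightarrow> k \<le> 2 * K \<Longrightarrow> good_at C k m"
    unfolding eventually_sequentially by (metis atMost_iff)
  define E where "E = C\<^sup>2 * (2 * C) powr (2 + 3 / real K)"
  have bound: "real q \<le> max (?y M ^ K) (E powr (1 / \<epsilon>))" if sol: "(p, q) \<in> ?S" for p q
  proof (cases "real q \<le> ?y M ^ K")
    case True
    then show ?thesis by simp
  next
    case False
    from sol have q0: "q > 0" and close: "\<bar>\<alpha> - of_int p / real q\<bar> < 1 / real q powr \<mu>" by auto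
    \<comment> \<open>With this \<open>T\<close>, the condition \<open>T < y ^ k\<close> is what makes \<open>q * \<bar>q' * \<alpha> - p'\<bar>\<close> at most \<open>1 / 2\<close>.\<close>
    define T where "T = 2 * C * real q"
    have "real q \<le> T" using C1 mult_right_mono[of 1 "2 * C" "real q"] by (simp add: T_def)
    then have TM: "?y M ^ K < T" using False by linarith
    then have T0: "T > 0" using y1[of M] by (meson less_trans zero_less_one zero_less_power)
    have unb: "\<exists>n. T < x ^ n" if "x > 1" for x :: real using real_arch_pow that by blast
    have "\<exists>m. T < ?y m ^ K"
    proof -
      obtain n where n: "T < \<beta> ^ n" using unb \<beta> by blast
      have "n * 1 \<le> 2 ^ n * K" using K0 less_exp[of n] by (intro mult_le_mono) auto
      then have "n \<le> 2 ^ n * K" by simp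
      then have "\<beta> ^ n \<le> ?y n ^ K" using \<beta> by (simp flip: power_mult add: power_increasing)
      then show ?thesis using n by (intro exI[of _ n]) linarith
    qed
    \<comment> \<open>Since \<open>(\<beta> ^ 2 ^ m)\<^sup>2 = \<beta> ^ 2 ^ Suc m\<close>, the intervals from \<open>y ^ K\<close> to \<open>y ^ (2 * K)\<close> for successive \<open>m\<close> are adjacent.\<close>
    define m1 where "m1 = (LEAST m. T < ?y m ^ K)"
    have m1: "T < ?y m1 ^ K" unfolding m1_def by (rule LeastI_ex) fact
    have "M < m1"
    proof (rule ccontr)
      assume "\<not> M < m1"
      then have "?y m1 ^ K \<le> ?y M ^ K" using \<beta> by (intro power_mono power_increasing) auto
      then show False using m1 TM by linarith
    qed
    then obtain m where m: "m1 = Suc m" "M \<le> m" by (metis less_Suc_eq_le lessE less_imp_Suc_add)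
    define y where "y = ?y m"
    have y: "y > 1" using y1 by (simp add: y_def)
    have yT: "y ^ K \<le> T"
      using not_less_Least[of m "\<lambda>m. T < ?y m ^ K"] m(1) by (simp add: m1_def y_def)
    have "?y m1 ^ K = y ^ (2 * K)"
      by (simp add: m(1) y_def flip: power_mult) (simp add: ac_simps)
    then have T2K: "T < y ^ (2 * K)" using m1 by simp
    define k where "k = (LEAST k. T < y ^ k)"
    have k: "T < y ^ k" "k \<le> 2 * K"
      unfolding k_def by (rule LeastI[of "\<lambda>k. T < y ^ k", OF T2K]) (rule Least_le[of "\<lambda>k. T < y ^ k", OF T2K])
    have "K < k"
    proof (rule ccontr)
      assume "\<not> K < k"
      then have "y ^ k \<le> y ^ K" using y by (intro power_increasing) auto
      then show False using yT k by linarith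
    qed
    then obtain l where l: "k = Suc l" by (cases k) auto
    have ylT: "y ^ l \<le> T"
      using not_less_Least[of l "\<lambda>k. T < y ^ k"] l by (simp add: k_def)
    have y3: "y ^ 3 \<le> T powr (3 / real K)"
    proof -
      have "y ^ K = y powr real K" "y ^ 3 = y powr 3" using y by (simp_all add: powr_realpow)
      then have "y ^ 3 = (y ^ K) powr (3 / real K)" using K0 by (simp only: powr_powr) simp
      also have "\<dots> \<le> T powr (3 / real K)" using yT y by (intro powr_mono2) auto
      finally show ?thesis .
    qed
    obtain p' q' :: int where pq: "\<bar>of_int q'\<bar> \<le> C * y ^ (k + 1)"
        "1 \<le> C * (y ^ k * \<bar>of_int q' * \<alpha> - of_int p'\<bar>)"
        "y ^ k * \<bar>of_int q' * \<alpha> - of_int p'\<bar> \<le> C"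
      using M[OF m(2) k(2)] unfolding y_def good_at_def by blast
    let ?e' = "of_int q' * \<alpha> - of_int p'" and ?e = "real q * \<alpha> - of_int p"
    have e: "real q powr \<mu> * \<bar>?e\<bar> \<le> real q"
    proof -
      have "\<bar>?e\<bar> = real q * \<bar>\<alpha> - of_int p / real q\<bar>"
      proof -
        have "?e = real q * (\<alpha> - of_int p / real q)" using q0 by (simp add: field_simps)
        then show ?thesis by (simp only: abs_mult abs_of_nat)
      qed
      also have "\<dots> \<le> real q * (1 / real q powr \<mu>)" using close by (intro mult_left_mono) auto
      finally show ?thesis using q0 by (simp add: field_simps)
    qed
    have main: "real q powr \<mu> \<le> C\<^sup>2 * (T\<^sup>2 * y ^ 3)"
    proof (cases "int q * p' = q' * p")
      case False
      have "1 \<le> \<bar>real_of_int (int q * p' - q' * p)\<bar>" using False by linarith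
      also have "real_of_int (int q * p' - q' * p) = of_int q' * ?e - real q * ?e'"
        by (simp add: algebra_simps)
      also have "\<bar>\<dots>\<bar> \<le> \<bar>of_int q'\<bar> * \<bar>?e\<bar> + real q * \<bar>?e'\<bar>"
        using abs_triangle_ineq4[of "of_int q' * ?e" "real q * ?e'"] by (simp add: abs_mult)
      finally have one: "1 \<le> \<bar>of_int q'\<bar> * \<bar>?e\<bar> + real q * \<bar>?e'\<bar>" .
      have "2 * (real q * \<bar>?e'\<bar>) * y ^ k \<le> 2 * real q * C"
        using mult_left_mono[OF pq(3), of "2 * real q"] by (simp add: ac_simps)
      also have "\<dots> \<le> 1 * y ^ k" using k(1) by (simp add: T_def ac_simps)
      finally have "2 * (real q * \<bar>?e'\<bar>) \<le> 1" using y by (subst (asm) mult_le_cancel_right_pos) auto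
      then have "1 \<le> 2 * (\<bar>of_int q'\<bar> * \<bar>?e\<bar>)" using one by linarith
      also have "\<dots> \<le> 2 * (C * y ^ (k + 1) * \<bar>?e\<bar>)" using pq(1) by (intro mult_left_mono mult_right_mono) auto
      finally have "real q powr \<mu> * 1 \<le> real q powr \<mu> * (2 * (C * y ^ (k + 1) * \<bar>?e\<bar>))"
        by (intro mult_left_mono) auto
      also have "\<dots> = 2 * C * y ^ (k + 1) * (real q powr \<mu> * \<bar>?e\<bar>)" by (simp add: ac_simps)
      also have "\<dots> \<le> 2 * C * y ^ (k + 1) * real q" using e C1 y by (intro mult_left_mono) auto
      also have "\<dots> = 1 * (T * (y ^ l * y ^ 2))"
        by (simp add: T_def l power2_eq_square)
      also have "\<dots> \<le> C\<^sup>2 * (T * (T * y ^ 3))"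
        using C1 y T0 ylT by (intro mult_mono power_increasing one_le_power) auto
      finally show ?thesis by (simp add: power2_eq_square ac_simps)
    next
      case True
      have "real_of_int (int q * p') = real_of_int (q' * p)" using True by (simp only:)
      then have "real q * ?e' = of_int q' * ?e" by (simp add: algebra_simps)
      then have eq: "real q * \<bar>?e'\<bar> = \<bar>of_int q'\<bar> * \<bar>?e\<bar>"
        by (metis abs_mult abs_of_nat)
      have "real q powr \<mu> * real q * 1 \<le> real q powr \<mu> * real q * (C * (y ^ k * \<bar>?e'\<bar>))"
        by (intro mult_left_mono pq(2)) auto
      also have "\<dots> = C * y ^ k * (real q powr \<mu> * (real q * \<bar>?e'\<bar>))" by (simp only: ac_simps)
      also have "\<dots> = C * y ^ k * (\<bar>of_int q'\<bar> * (real q powr \<mu> * \<bar>?e\<bar>))"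
        unfolding eq by (simp only: ac_simps)
      also have "\<dots> \<le> C * y ^ k * (C * y ^ (k + 1) * real q)"
        using C1 y e pq(1) by (intro mult_left_mono mult_mono) auto
      finally have "real q powr \<mu> \<le> C * y ^ k * (C * y ^ (k + 1))" using q0 by simp
      also have "\<dots> = C\<^sup>2 * (y ^ l * y ^ l * y ^ 3)"
        by (simp add: l power2_eq_square numeral_3_eq_3 ac_simps)
      also have "\<dots> \<le> C\<^sup>2 * (T * T * y ^ 3)"
        using ylT y T0 by (intro mult_mono mult_nonneg_nonneg) auto
      finally show ?thesis by (simp add: power2_eq_square)
    qed
    also have "\<dots> \<le> C\<^sup>2 * (T\<^sup>2 * T powr (3 / real K))"
      using y3 by (intro mult_left_mono) auto
    also have "T\<^sup>2 * T powr (3 / real K) = T powr (2 + 3 / real K)"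
      using T0 by (simp add: powr_add)
    also have "C\<^sup>2 * \<dots> = E * real q powr (2 + 3 / real K)"
      using C1 by (simp add: E_def T_def powr_mult)
    finally have "real q powr (\<epsilon> + (2 + 3 / real K)) \<le> E * real q powr (2 + 3 / real K)"
      by (simp add: \<epsilon>_def)
    then have "real q powr \<epsilon> \<le> E" using q0 by (simp add: powr_add)
    then have "(real q powr \<epsilon>) powr (1 / \<epsilon>) \<le> E powr (1 / \<epsilon>)" using \<epsilon> by (intro powr_mono2) auto
    then show ?thesis using \<epsilon> by (simp add: powr_powr)
  qed
  obtain N :: nat where N: "max (?y M ^ K) (E powr (1 / \<epsilon>)) \<le> N"
    using real_arch_simple by blast
  define L where "L = \<lceil>real N * (\<bar>\<alpha>\<bar> + 1)\<rceil>"
  have "?S \<subseteq> {- L..L} \<times> {..N}"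
  proof (rule subrelI)
    fix p q assume sol: "(p, q) \<in> ?S"
    have qN: "q \<le> N" using bound[OF sol] N by linarith
    from sol have q0: "q > 0" and close: "\<bar>\<alpha> - of_int p / real q\<bar> < 1 / real q powr \<mu>" by auto
    have "real q powr \<mu> \<ge> 1" using q0 \<mu> by (intro ge_one_powr_ge_zero) auto
    then have "1 / real q powr \<mu> \<le> 1" by (metis divide_le_eq_1_pos less_le_trans zero_less_one)
    then have "\<bar>of_int p / real q\<bar> \<le> \<bar>\<alpha>\<bar> + 1" using close by linarith
    then have "\<bar>of_int p\<bar> \<le> real q * (\<bar>\<alpha>\<bar> + 1)" using q0 by (simp add: field_simps)
    also have "\<dots> \<le> real N * (\<bar>\<alpha>\<bar> + 1)" using qN by (intro mult_right_mono) auto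
    finally have "\<bar>real_of_int p\<bar> \<le> real_of_int L" unfolding L_def by linarith
    then show "(p, q) \<in> {- L..L} \<times> {..N}" using qN by auto
  qed
  then show ?thesis by (rule finite_subset) simp
qed

text \<open>For rational \<open>\<alpha>\<close> the multiples of one representing pair are solutions; for irrational \<open>\<alpha>\<close> this is
  Dirichlet's theorem.\<close>

lemma infinite_square_approximations:
  fixes \<alpha> :: real
  shows "infinite {(p :: int, q :: nat). q > 0 \<and> \<bar>\<alpha> - of_int p / real q\<bar> < 1 / real q powr 2}"
    (is "infinite ?S")
proof (cases "\<alpha> \<in> \<rat>")
  case True
  then obtain p d :: int where "d > 0" "\<alpha> = of_int p / of_int d" by (meson Rats_cases')
  moreover define q where "q = nat d"
  ultimately have \<alpha>: "\<alpha> = of_int p / real q" and q: "q > 0" by simp_all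
  let ?f = "\<lambda>n :: nat. (p * int (Suc n), q * Suc n)"
  have inj: "inj ?f" using q by (auto simp: inj_on_def simp del: mult_Suc_right)
  have "range ?f \<subseteq> ?S"
  proof (rule image_subsetI)
    fix n :: nat
    have "real_of_int (p * int (Suc n)) / real (q * Suc n) = \<alpha>" unfolding \<alpha> of_int_mult of_nat_mult
      by (simp only: of_int_of_nat_eq) (simp del: of_nat_Suc)
    then have "\<bar>\<alpha> - real_of_int (p * int (Suc n)) / real (q * Suc n)\<bar> = 0" by linarith
    moreover have pos: "q * Suc n > 0" using q by (intro mult_pos_pos) simp_all
    then have "0 < 1 / real (q * Suc n) powr 2" by (simp only: zero_less_divide_1_iff powr_gt_zero of_nat_eq_0_iff)
    ultimately show "?f n \<in> ?S" using pos by (simp only: mem_Collect_eq case_prod_conv)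
  qed
  then show ?thesis using range_inj_infinite[OF inj] by (rule infinite_super)
next
  case False
  have "approx_set \<alpha> \<subseteq> (\<lambda>(p, q). (p, int q)) ` ?S"
  proof (rule subrelI)
    fix h k assume "(h, k) \<in> approx_set \<alpha>"
    then have k: "k > 0" and "\<bar>\<alpha> - of_int h / of_int k\<bar> < 1 / (of_int k)\<^sup>2" by (auto simp: approx_set_def)
    then have "(h, nat k) \<in> ?S" by simp
    then show "(h, k) \<in> (\<lambda>(p, q). (p, int q)) ` ?S" by (rule rev_image_eqI) (use k in simp)
  qed
  moreover have "infinite (approx_set \<alpha>)" using False by (simp add: rational_iff_finite_approx_set)
  ultimately have "infinite ((\<lambda>(p, q). (p, int q)) ` ?S)" by (rule infinite_super)
  then show ?thesis by (rule contrapos_nn) (rule finite_imageI)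
qed

theorem theorem1p1:
  fixes b :: int
  assumes "b \<ge> 2"
  shows "irrationality_exponent (\<Sum>n. real (s2 n) / real_of_int b ^ n) = 2"
proof (rule antisym)
  let ?\<alpha> = "\<Sum>n. real (s2 n) / real_of_int b ^ n"
  show "irrationality_exponent ?\<alpha> \<le> 2"
    unfolding irrationality_exponent_def
  proof (rule Sup_least)
    fix x assume "x \<in> ereal ` {\<mu>. infinite {(p :: int, q :: nat). q > 0 \<and>
        \<bar>?\<alpha> - real_of_int p / real q\<bar> < 1 / real q powr \<mu>}}"
    then obtain \<mu> where x: "x = ereal \<mu>" and inf: "infinite {(p :: int, q :: nat). q > 0 \<and>
        \<bar>?\<alpha> - real_of_int p / real q\<bar> < 1 / real q powr \<mu>}" by blast
    have "\<not> \<mu> > 2"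
      using inf finite_solutions_of_good_approximations[OF _ _ good_approximations[OF assms], of \<mu>] assms
      by auto
    then show "x \<le> 2" by (simp add: x)
  qed
  show "2 \<le> irrationality_exponent ?\<alpha>"
    unfolding irrationality_exponent_def
    using infinite_square_approximations[of ?\<alpha>] by (intro Sup_upper) (auto intro!: image_eqI[of _ _ 2])
qed

end
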